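(* Let $r$ be a positive integer and let $\mathbb{D}_{n}^{(r)}(x)$ be defined by $\frac{e^{z}}{(1-xz)^{r}}=\sum_{n\geq0}\mathbb{D}_{n}^{(r)}(x)\frac{z^{n}}{n!}$. Then for every integer $n\ge0$ (and every $z$), \[\det\left(\mathbb{D}_{i+j-2}^{(r)}(z)\right)_{1\leq i,j\leq n+1}=z^{n(n+1)}\,r^{\overline{n}}\prod_{k=1}^{n}r^{\overline{k-1}}\,k!,\] where $r^{\overline{k}}=r(r+1)\cdots(r+k-1)$ and $r^{\overline{0}}=1$.
   Context: The generating function identity is an identity of formal power series in $z$; equivalently $\mathbb{D}_{n}^{(r)}(x)=\sum_{k=0}^{n}\binom{n}{k}r^{\overline{k}}x^{k}$. *)

theory Defs
  imports "HOL-Computational_Algebra.Formal_Power_Series" "Jordan_Normal_Form.Determinant"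
begin

text \<open>
  The formal variable of the generating function is \<open>fps_X\<close>, and the coefficients lie in an
  arbitrary field of characteristic 0 (so that dividing by \<open>n!\<close> is meaningful); the argument
  \<open>x\<close> is an element of that field. The denominator has constant term 1, hence the division
  below is multiplication by its inverse power series.
\<close>

definition gen_D :: "nat \<Rightarrow> 'a::field_char_0 \<Rightarrow> 'a fps" where
  "gen_D r x = fps_exp 1 / (1 - fps_const x * fps_X) ^ r"

definition D :: "nat \<Rightarrow> nat \<Rightarrow> 'a::field_char_0 \<Rightarrow> 'a" where
  "D r n x = fact n * fps_nth (gen_D r x) n"

lemma gen_D_eq: "gen_D r x = Abs_fps (\<lambda>n. D r n x / fact n)"
  by (simp add: fps_eq_iff D_def)

lemma gen_D_mult: "gen_D r x * (1 - fps_const x * fps_X) ^ r = fps_exp 1"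
proof -
  have "fps_nth ((1 - fps_const x * fps_X) ^ r) 0 \<noteq> 0"
    by (simp add: fps_nth_power_0)
  then show ?thesis
    by (simp add: gen_D_def fps_divide_unit mult.assoc inverse_mult_eq_1)
qed

end

theory Submission
  imports Defs
begin

text \<open>
  Writing \<open>u(s) = 1 - xs\<close>, one has \<open>u(s + t) = u(s) u(t) (1 - x\<^sup>2st / (u(s) u(t)))\<close>. Expanding the
  \<open>r\<close>-th inverse power by the binomial series shows that the generating function at \<open>s + t\<close> is
  \<open>\<Sum>k. d\<^sub>k g\<^sub>k(s) g\<^sub>k(t)\<close> with \<open>g\<^sub>k(s) = s\<^sup>k e\<^sup>s u(s)\<^sup>-\<^sup>r\<^sup>-\<^sup>k / k!\<close> and \<open>d\<^sub>k = r(r+1)\<dots>(r+k-1) k! x\<^sup>2\<^sup>k\<close>.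
  In terms of coefficients this is an LDU factorisation of the Hankel matrix with unipotent
  factors, so the determinant is the product of the \<open>d\<^sub>k\<close>. Bivariate power series can
  be avoided: the three-term relation for the derivative of \<open>g\<^sub>k\<close> makes
  \<open>\<Sum>k. d\<^sub>k L\<^sub>i\<^sub>k L\<^sub>j\<^sub>k\<close> depend on \<open>i + j\<close> only, and \<open>i = 0\<close> identifies it.
\<close>

definition col_gf :: "nat \<Rightarrow> 'a::field_char_0 \<Rightarrow> nat \<Rightarrow> 'a fps" where
  "col_gf r x k = fps_X ^ k * fps_exp 1 * inverse (1 - fps_const x * fps_X) ^ (r + k)"

text \<open>The factor 1/k! of g_k sits here rather than in \<open>col_gf\<close>, making this an
  exponential Riordan array with unit diagonal.\<close>

definition L_entry :: "nat \<Rightarrow> 'a::field_char_0 \<Rightarrow> nat \<Rightarrow> nat \<Rightarrow> 'a" where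
  "L_entry r x i k = fact i * fps_nth (col_gf r x k) i / fact k"

definition pivot :: "nat \<Rightarrow> 'a::field_char_0 \<Rightarrow> nat \<Rightarrow> 'a" where
  "pivot r x k = pochhammer (of_nat r) k * fact k * x ^ (2 * k)"

lemma inverse_one_minus_cX:
  fixes x :: "'a::field_char_0"
  defines "w \<equiv> inverse (1 - fps_const x * fps_X)"
  shows "w = 1 + fps_const x * fps_X * w"
    and "fps_deriv w = fps_const x * w\<^sup>2"
proof -
  have "w * (1 - fps_const x * fps_X) = 1"
    unfolding w_def by (rule inverse_mult_eq_1) simp
  then show "w = 1 + fps_const x * fps_X * w"
    by (simp add: algebra_simps)
  show "fps_deriv w = fps_const x * w\<^sup>2"
    unfolding w_def by (subst fps_inverse_deriv) simp_all
qed

lemma fps_deriv_inverse_power: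
  fixes x :: "'a::field_char_0"
  defines "w \<equiv> inverse (1 - fps_const x * fps_X)"
  shows "fps_deriv (w ^ m) = of_nat m * fps_const x * w ^ Suc m"
proof (induction m)
  case (Suc m)
  have "fps_deriv (w ^ Suc m) = fps_deriv w * w ^ m + w * fps_deriv (w ^ m)"
    by (simp add: algebra_simps)
  then show ?case
    unfolding Suc.IH inverse_one_minus_cX(2)[of x, folded w_def]
    by (simp add: algebra_simps power2_eq_square)
qed simp

lemma fps_deriv_col_gf_0:
  fixes x :: "'a::field_char_0"
  shows "fps_deriv (col_gf r x 0) = (1 + of_nat r * fps_const x) * col_gf r x 0
    + of_nat r * fps_const x ^ 2 * col_gf r x 1"
proof -
  define w where "w = inverse (1 - fps_const x * fps_X)"
  note w = inverse_one_minus_cX(1)[of x, folded w_def]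
  define E :: "'a fps" where "E = fps_exp 1"
  have dE: "fps_deriv E = E"
    by (simp add: E_def)
  have "fps_deriv (col_gf r x 0) = E * w ^ r + of_nat r * fps_const x * E * w ^ r * w"
    unfolding col_gf_def w_def[symmetric] E_def[symmetric] fps_deriv_mult dE
      fps_deriv_inverse_power[of x, folded w_def]
    by (simp add: algebra_simps)
  also have "\<dots> = E * w ^ r + of_nat r * fps_const x * E * w ^ r * (1 + fps_const x * fps_X * w)"
    using w by simp
  finally show ?thesis
    unfolding col_gf_def w_def[symmetric] E_def[symmetric]
    by (simp add: algebra_simps power2_eq_square del: fps_const_power fps_const_mult)
qed

lemma fps_deriv_col_gf_Suc:
  fixes x :: "'a::field_char_0"
  shows "fps_deriv (col_gf r x (Suc k)) = of_nat (Suc k) * col_gf r x k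
    + (1 + of_nat (r + 2 * Suc k) * fps_const x) * col_gf r x (Suc k)
    + of_nat (r + Suc k) * fps_const x ^ 2 * col_gf r x (Suc (Suc k))"
proof -
  define w where "w = inverse (1 - fps_const x * fps_X)"
  define E :: "'a fps" where "E = fps_exp 1"
  have dE: "fps_deriv E = E"
    by (simp add: E_def)
  note w = inverse_one_minus_cX(1)[of x, folded w_def]
  have dX: "fps_deriv (fps_X ^ Suc k :: 'a fps) = of_nat (Suc k) * fps_X ^ k"
    by (subst fps_deriv_power) (simp add: fps_of_nat del: of_nat_Suc)
  have "fps_deriv (col_gf r x (Suc k)) =
      of_nat (Suc k) * fps_X ^ k * E * w ^ (r + k) * w
      + fps_X ^ Suc k * E * w ^ (r + Suc k)
      + of_nat (r + Suc k) * fps_const x * fps_X ^ Suc k * E * w ^ (r + Suc k) * w"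
    unfolding col_gf_def w_def[symmetric] E_def[symmetric] fps_deriv_mult dX dE
      fps_deriv_inverse_power[of x, folded w_def]
    by (simp add: algebra_simps)
  \<comment> \<open>Two terms carry one \<open>w\<close> too many for their column; w = 1 + xXw
    splits each into that column and x times the next.\<close>
  also have "\<dots> =
      of_nat (Suc k) * fps_X ^ k * E * w ^ (r + k) * (1 + fps_const x * fps_X * w)
      + fps_X ^ Suc k * E * w ^ (r + Suc k)
      + of_nat (r + Suc k) * fps_const x * fps_X ^ Suc k * E * w ^ (r + Suc k)
        * (1 + fps_const x * fps_X * w)"
    using w by simp
  finally show ?thesis
    unfolding col_gf_def w_def[symmetric] E_def[symmetric]
    by (simp add: algebra_simps power2_eq_square del: fps_const_power fps_const_mult)
qed

lemma L_entry_Suc_left: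
  "L_entry r x (Suc i) k = fact i * fps_nth (fps_deriv (col_gf r x k)) i / fact k"
  by (simp add: L_entry_def algebra_simps)

lemma fps_nth_of_nat_mult: "fps_nth (of_nat m * f) i = of_nat m * fps_nth f i"
  for f :: "'a::comm_ring_1 fps"
  by (simp flip: fps_of_nat)

lemma L_entry_Suc_0:
  "L_entry r x (Suc i) 0 = (1 + of_nat r * x) * L_entry r x i 0 + of_nat r * x\<^sup>2 * L_entry r x i 1"
  by (simp add: L_entry_Suc_left fps_deriv_col_gf_0 del: fps_deriv_nth)
     (simp add: L_entry_def algebra_simps fps_nth_of_nat_mult)

text \<open>Differentiating an exponential generating function shifts i. The 1/k! normalisation
  makes the last coefficient exactly the ratio of consecutive pivots
  (\<open>pivot_Suc\<close>).\<close>

lemma L_entry_Suc_Suc: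
  "L_entry r x (Suc i) (Suc k) = L_entry r x i k
    + (1 + of_nat (r + 2 * Suc k) * x) * L_entry r x i (Suc k)
    + of_nat (r + Suc k) * of_nat (k + 2) * x\<^sup>2 * L_entry r x i (Suc (Suc k))"
  by (simp add: L_entry_Suc_left fps_deriv_col_gf_Suc
        del: fps_deriv_nth of_nat_Suc of_nat_add)
     (simp add: L_entry_def fps_nth_of_nat_mult field_simps del: of_nat_Suc of_nat_add)

lemma L_entry_eq_0: "i < k \<Longrightarrow> L_entry r x i k = 0"
  by (simp add: L_entry_def col_gf_def mult.assoc fps_X_power_mult_nth)

lemma L_entry_diag: "L_entry r x k k = 1"
  by (simp add: L_entry_def col_gf_def mult.assoc fps_X_power_mult_nth fps_nth_power_0)

lemma L_entry_0_left: "L_entry r x 0 k = (if k = 0 then 1 else 0)"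
  by (simp add: L_entry_eq_0 L_entry_diag)

lemma D_eq_L_entry: "D r n x = L_entry r x n 0"
  by (simp add: D_def gen_D_def L_entry_def col_gf_def fps_divide_unit fps_nth_power_0
      fps_inverse_power)

lemma pivot_Suc: "pivot r x (Suc k) = of_nat (r + k) * of_nat (Suc k) * x\<^sup>2 * pivot r x k"
  by (simp add: pivot_def pochhammer_Suc power2_eq_square algebra_simps)

text \<open>A Christoffel-Darboux argument: the three-term recurrence is symmetric with respect to
  the weights \<open>pivot\<close>, so all but the boundary cross terms cancel.\<close>

lemma sum_L_pivot_L_telescope:
  "(\<Sum>k\<le>N. pivot r x k * (L_entry r x (Suc i) k * L_entry r x j k - L_entry r x i k * L_entry r x (Suc j) k))
    = pivot r x (Suc N) * (L_entry r x i (Suc N) * L_entry r x j N - L_entry r x i N * L_entry r x j (Suc N))"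
proof (induction N)
  case 0
  show ?case
    by (simp add: L_entry_Suc_0 pivot_Suc algebra_simps)
next
  case (Suc N)
  show ?case
    unfolding sum.atMost_Suc Suc.IH L_entry_Suc_Suc pivot_Suc[of r x "Suc N"]
    by (simp add: algebra_simps)
qed

lemma D_add_eq_sum:
  assumes "i + j \<le> N"
  shows "D r (i + j) x = (\<Sum>k\<le>N. L_entry r x i k * (pivot r x k * L_entry r x j k))"
  using assms
proof (induction i arbitrary: j)
  case 0
  have "(\<Sum>k\<le>N. L_entry r x 0 k * (pivot r x k * L_entry r x j k))
      = (\<Sum>k\<in>{0}. L_entry r x 0 k * (pivot r x k * L_entry r x j k))"
    by (rule sum.mono_neutral_right) (auto simp: L_entry_0_left)
  then show ?case
    by (simp add: L_entry_0_left D_eq_L_entry pivot_def)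
next
  case (Suc i)
  \<comment> \<open>One unit moves from i to j; the boundary term vanishes because i and j lie below
    N + 1.\<close>
  have "(\<Sum>k\<le>N. L_entry r x (Suc i) k * (pivot r x k * L_entry r x j k))
      - (\<Sum>k\<le>N. L_entry r x i k * (pivot r x k * L_entry r x (Suc j) k)) = 0"
    using sum_L_pivot_L_telescope[of r x i j N] Suc.prems
    by (simp add: L_entry_eq_0 algebra_simps sum_subtractf)
  with Suc.IH[of "Suc j"] Suc.prems show ?case
    by simp
qed

text \<open>Row i vanishes from column m on, so the sum can be cut to the matrix size even when i +
  j exceeds it.\<close>

lemma D_add_eq_sum_lessThan:
  assumes "i < m"
  shows "D r (i + j) x = (\<Sum>k<m. L_entry r x i k * (pivot r x k * L_entry r x j k))"
proof -
  have "(\<Sum>k\<le>i + j + m. L_entry r x i k * (pivot r x k * L_entry r x j k))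
      = (\<Sum>k<m. L_entry r x i k * (pivot r x k * L_entry r x j k))"
    by (rule sum.mono_neutral_right) (use assms in \<open>auto simp: L_entry_eq_0\<close>)
  then show ?thesis
    using D_add_eq_sum[of i j "i + j + m" r x] by simp
qed

lemma det_hankel_D:
  "det (mat m m (\<lambda>(i, j). D r (i + j) x)) = (\<Prod>k<m. pivot r x k)"
proof -
  define A where "A = mat m m (\<lambda>(i, k). L_entry r x i k)"
  \<comment> \<open>The diagonal and transposed factors are merged into one upper triangular
    matrix.\<close>
  define B where "B = mat m m (\<lambda>(k, j). pivot r x k * L_entry r x j k)"
  have A: "A \<in> carrier_mat m m" and B: "B \<in> carrier_mat m m"
    by (simp_all add: A_def B_def)
  have "mat m m (\<lambda>(i, j). D r (i + j) x) = A * B"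
    by (rule eq_matI)
       (auto simp: A_def B_def scalar_prod_def D_add_eq_sum_lessThan lessThan_atLeast0)
  moreover have "det A = 1"
    by (subst det_lower_triangular[OF _ A])
       (auto simp: A_def L_entry_eq_0 L_entry_diag prod_list_diag_prod)
  moreover have "det B = (\<Prod>k<m. pivot r x k)"
    by (subst det_upper_triangular[OF _ B])
       (auto simp: B_def L_entry_eq_0 L_entry_diag prod_list_diag_prod lessThan_atLeast0)
  ultimately show ?thesis
    by (simp add: det_mult[OF A B])
qed

lemma prod_pivot:
  "(\<Prod>k<Suc n. pivot r x k) = x ^ (n * (n + 1)) * pochhammer (of_nat r) n *
    (\<Prod>k=1..n. pochhammer (of_nat r) (k - 1) * fact k)"
proof (induction n)
  case (Suc n)
  have "Suc n * (Suc n + 1) = n * (n + 1) + 2 * Suc n"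
    by simp
  then have "x ^ (Suc n * (Suc n + 1)) = x ^ (n * (n + 1)) * x ^ (2 * Suc n)"
    by (simp only: power_add)
  \<comment> \<open>The old leading factor \<open>pochhammer (of_nat r) n\<close> becomes the factor
    k = n + 1 of the product, hence the index k - 1 there.\<close>
  then show ?case
    unfolding prod.lessThan_Suc[of _ "Suc n"] Suc.IH pivot_def[of r x "Suc n"]
    by (simp only: prod.nat_ivl_Suc' le_add2 plus_1_eq_Suc diff_Suc_1 mult_ac)
qed (simp add: pivot_def)

theorem theorem15:
  fixes r n :: nat and z :: "'a::field_char_0"
  assumes "r > 0"
  shows "det (mat (n + 1) (n + 1) (\<lambda>(i, j). D r (i + j) z)) =
    z ^ (n * (n + 1)) * pochhammer (of_nat r) n *
      (\<Prod>k=1..n. pochhammer (of_nat r) (k - 1) * fact k)"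
  using prod_pivot[where x = z] det_hankel_D[where x = z] by simp

end
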